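(* An $n\times n$ matrix $A$ with commutative quaternion coefficients has $2n$ eigenvalues which are complex numbers.
   Context: The commutative quaternions are the elements of the set $H=\{q=t+ix+jy+kz : t,x,y,z\in\mathbb{R},\ i,j,k\notin\mathbb{R}\}$, with commutative multiplication determined by the rules $i^2=k^2=-1$, $j^2=1$, $ijk=-1$, $ij=ji=k$, $jk=kj=i$, $ki=ik=-j$ for the basis elements $i,j,k$. The commutative quaternions of the form $\alpha+i\beta$ ($\alpha,\beta\in\mathbb{R}$) form an algebraically closed commutative field $C\subset H$ isomorphic to the field of ordinary complex numbers, and are simply called complex numbers. For an $n\times n$ matrix $A$ with coefficients in $H$, an eigenvalue of $A$ is here restricted to be a complex number: it is a $\lambda\in C$ such that $Ax=\lambda x$ for some non-zero column vector $x$ ($n\times 1$ matrix) with components in $H$. *)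

theory Defs
  imports "HOL-Analysis.Analysis"
begin

text \<open>The commutative quaternion \<open>t + i x + j y + k z\<close> is \<open>CQuat t x y z\<close>.\<close>

datatype cquat = CQuat (cq_t: real) (cq_x: real) (cq_y: real) (cq_z: real)

lemma cquat_eq_iff:
  "p = q \<longleftrightarrow> cq_t p = cq_t q \<and> cq_x p = cq_x q \<and> cq_y p = cq_y q \<and> cq_z p = cq_z q"
  by (cases p; cases q) simp

text \<open>The product is the bilinear extension of
  \<open>i\<^sup>2 = k\<^sup>2 = -1\<close>, \<open>j\<^sup>2 = 1\<close>, \<open>ij = ji = k\<close>, \<open>jk = kj = i\<close>, \<open>ki = ik = -j\<close>;
  see \<open>cquat_basis_rules\<close> and \<open>cquat_expand\<close> below.\<close>

instantiation cquat :: "{comm_ring_1, real_algebra_1}"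
begin

definition "0 = CQuat 0 0 0 0"
definition "1 = CQuat 1 0 0 0"
definition "p + q = CQuat (cq_t p + cq_t q) (cq_x p + cq_x q) (cq_y p + cq_y q) (cq_z p + cq_z q)"
definition "p - q = CQuat (cq_t p - cq_t q) (cq_x p - cq_x q) (cq_y p - cq_y q) (cq_z p - cq_z q)"
definition "- p = CQuat (- cq_t p) (- cq_x p) (- cq_y p) (- cq_z p)"
definition "p * q = CQuat
  (cq_t p * cq_t q - cq_x p * cq_x q + cq_y p * cq_y q - cq_z p * cq_z q)
  (cq_t p * cq_x q + cq_x p * cq_t q + cq_y p * cq_z q + cq_z p * cq_y q)
  (cq_t p * cq_y q + cq_y p * cq_t q - cq_x p * cq_z q - cq_z p * cq_x q)
  (cq_t p * cq_z q + cq_z p * cq_t q + cq_x p * cq_y q + cq_y p * cq_x q)"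
definition "r *\<^sub>R p = CQuat (r * cq_t p) (r * cq_x p) (r * cq_y p) (r * cq_z p)" for r :: real

lemmas cquat_defs = zero_cquat_def one_cquat_def plus_cquat_def minus_cquat_def
  uminus_cquat_def times_cquat_def scaleR_cquat_def

instance
  by standard (simp_all add: cquat_eq_iff cquat_defs algebra_simps)

end

definition cq_i :: cquat where "cq_i = CQuat 0 1 0 0"
definition cq_j :: cquat where "cq_j = CQuat 0 0 1 0"
definition cq_k :: cquat where "cq_k = CQuat 0 0 0 1"

lemma cquat_basis_rules:
  "cq_i * cq_i = -1" "cq_k * cq_k = -1" "cq_j * cq_j = 1" "cq_i * cq_j * cq_k = -1"
  "cq_i * cq_j = cq_k" "cq_j * cq_i = cq_k"
  "cq_j * cq_k = cq_i" "cq_k * cq_j = cq_i"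
  "cq_k * cq_i = - cq_j" "cq_i * cq_k = - cq_j"
  by (simp_all add: cquat_defs cq_i_def cq_j_def cq_k_def)

lemma cquat_expand:
  "CQuat t x y z = of_real t + cq_i * of_real x + cq_j * of_real y + cq_k * of_real z"
  by (simp add: cquat_defs of_real_def cq_i_def cq_j_def cq_k_def)

text \<open>The embedding of the complex numbers, with image the subfield \<open>C\<close> of all \<open>\<alpha> + i \<beta>\<close>.\<close>

definition cq_of_complex :: "complex \<Rightarrow> cquat" where
  "cq_of_complex c = of_real (Re c) + cq_i * of_real (Im c)"

lemma cq_of_complex_eq: "cq_of_complex c = CQuat (Re c) (Im c) 0 0"
  by (simp add: cq_of_complex_def cquat_defs of_real_def cq_i_def)

lemma cq_of_complex_hom:
  "cq_of_complex 0 = 0" "cq_of_complex 1 = 1"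
  "cq_of_complex (a + b) = cq_of_complex a + cq_of_complex b"
  "cq_of_complex (a * b) = cq_of_complex a * cq_of_complex b"
  by (simp_all add: cq_of_complex_eq cquat_defs)

lemma inj_cq_of_complex: "inj cq_of_complex"
  by (simp add: inj_def cq_of_complex_eq complex_eq_iff)

definition complex_eigenvalue :: "cquat ^ 'n ^ 'n \<Rightarrow> complex \<Rightarrow> bool" where
  "complex_eigenvalue A l \<longleftrightarrow> (\<exists>x. x \<noteq> 0 \<and> A *v x = cq_of_complex l *s x)"

text \<open>Column vectors over the commutative quaternions form a complex vector space, by restriction
  of scalars along \<^const>\<open>cq_of_complex\<close>; \<open>cq.dim\<close> is the dimension over the complex numbers.\<close>

definition cq_scale :: "complex \<Rightarrow> cquat ^ 'n \<Rightarrow> cquat ^ 'n" where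
  "cq_scale c x = cq_of_complex c *s x"

interpretation cq: vector_space cq_scale
  by standard (simp_all add: cq_scale_def vec_eq_iff cq_of_complex_hom algebra_simps)

definition gen_eigenspace :: "cquat ^ 'n ^ 'n \<Rightarrow> complex \<Rightarrow> (cquat ^ 'n) set" where
  "gen_eigenspace A l = {x. \<exists>m. ((\<lambda>y. A *v y - cq_of_complex l *s y) ^^ m) x = 0}"

text \<open>Eigenvalues are counted with algebraic multiplicity, that is, with the complex dimension of
  the generalized eigenspace.\<close>

definition alg_mult :: "cquat ^ 'n ^ 'n \<Rightarrow> complex \<Rightarrow> nat" where
  "alg_mult A l = cq.dim (gen_eigenspace A l)"

end

theory Submission
  imports Defs "HOL-Computational_Algebra.Fundamental_Theorem_Algebra"
begin

text \<open>The equation \<open>t + i x + j y + k z = (t + i x) + (y + i z) j\<close> shows that the commutative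
  quaternions are a two-dimensional vector space over the complex numbers. Column vectors of length
  \<open>n\<close> therefore form a complex vector space of dimension \<open>2 n\<close> (\<open>card_cq_basis\<close>,
  \<open>cq_fin\<close>). Multiplication by a matrix is complex linear because the quaternions commute, so
  the claim is the classical fact that the algebraic multiplicities of the eigenvalues of an
  endomorphism add up to the dimension of the space, over any algebraically closed field
  (\<open>sum_dim_gen_eig_on\<close>).

  That fact is proved without determinants, by induction on the dimension of an invariant subspace
  \<open>W\<close>. If \<open>W\<close> is nonzero it contains an eigenvector, for an eigenvalue \<open>l\<close>
  (\<open>eigenvalue_exists\<close>). Fitting's decomposition (\<open>fitting_decomposition\<close>) splits
  \<open>W\<close> into its intersection with the generalized eigenspace of \<open>l\<close> and an invariant
  complement \<open>U\<close> of smaller dimension. Passing from \<open>W\<close> to \<open>U\<close> only removes the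
  eigenvalue \<open>l\<close>: the generalized eigenvectors in \<open>W\<close> for the other eigenvalues all lie in
  \<open>U\<close>, since generalized eigenspaces for distinct scalars meet in zero
  (\<open>gen_eig_disjoint\<close>).\<close>

section \<open>Endomorphisms of finite-dimensional spaces over algebraically closed fields\<close>

locale endomorphism =
  finite_dimensional_vector_space scale Basis + f: Vector_Spaces.linear scale scale f
  for scale :: "'a :: alg_closed_field \<Rightarrow> 'b :: ab_group_add \<Rightarrow> 'b" (infixr \<open>\<odot>\<close> 75)
    and Basis :: "'b set"
    and f :: "'b \<Rightarrow> 'b"
begin

definition shift :: "'a \<Rightarrow> 'b \<Rightarrow> 'b" where
  "shift l x = f x - l \<odot> x"

definition gen_eig :: "'a \<Rightarrow> 'b set" where
  "gen_eig l = {x. \<exists>m. (shift l ^^ m) x = 0}"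

definition eigenvalues_on :: "'b set \<Rightarrow> 'a set" where
  "eigenvalues_on W = {l. \<exists>x\<in>W. x \<noteq> 0 \<and> f x = l \<odot> x}"

definition poly_act :: "'a poly \<Rightarrow> 'b \<Rightarrow> 'b" where
  "poly_act p v = (\<Sum>i\<le>degree p. coeff p i \<odot> (f ^^ i) v)"

lemma linear_shift: "Vector_Spaces.linear scale scale (shift l)"
  unfolding shift_def
  by unfold_locales (simp_all add: f.add f.scale algebra_simps)

lemma linear_shift_pow: "Vector_Spaces.linear scale scale (shift l ^^ m)"
proof (induction m)
  case 0
  then show ?case
    unfolding funpow.simps by (rule linear_id)
next
  case (Suc m)
  then show ?case
    unfolding funpow.simps by (rule Vector_Spaces.linear_compose[OF _ linear_shift])
qed

lemmas module_hom_shift_pow = linear_shift_pow[unfolded linear_iff_module_hom]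
lemmas shift_pow_add = module_hom.add[OF module_hom_shift_pow]
  and shift_pow_diff = module_hom.diff[OF module_hom_shift_pow]
  and shift_pow_scale = module_hom.scale[OF module_hom_shift_pow]
  and shift_pow_0 = module_hom.zero[OF module_hom_shift_pow]

lemma shift_pow_mono:
  assumes "(shift l ^^ m) x = 0" "m \<le> n"
  shows "(shift l ^^ n) x = 0"
proof -
  have "(shift l ^^ n) x = (shift l ^^ (n - m)) ((shift l ^^ m) x)"
    using assms(2) by (metis comp_apply funpow_add le_add_diff_inverse2)
  then show ?thesis
    using assms(1) by (simp add: shift_pow_0)
qed

lemma f_shift_pow: "f ((shift l ^^ n) x) = (shift l ^^ n) (f x)"
  by (induction n) (simp_all add: shift_def f.diff f.scale)

lemma shift_shift_pow: "shift m ((shift l ^^ n) x) = (shift l ^^ n) (shift m x)"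
  by (simp add: shift_def f_shift_pow shift_pow_diff shift_pow_scale)

lemma subspace_gen_eig: "subspace (gen_eig l)"
proof (rule subspaceI)
  show "0 \<in> gen_eig l"
    by (auto simp: gen_eig_def intro: exI[of _ 0])
next
  fix x y
  assume "x \<in> gen_eig l" "y \<in> gen_eig l"
  then obtain m n where "(shift l ^^ m) x = 0" "(shift l ^^ n) y = 0"
    by (auto simp: gen_eig_def)
  then have "(shift l ^^ max m n) x = 0" "(shift l ^^ max m n) y = 0"
    using shift_pow_mono by (metis max.cobounded1, metis max.cobounded2)
  then show "x + y \<in> gen_eig l"
    unfolding gen_eig_def by (auto simp: shift_pow_add intro!: exI[of _ "max m n"])
next
  fix c x
  assume "x \<in> gen_eig l"
  then show "c \<odot> x \<in> gen_eig l"
    by (auto simp: gen_eig_def shift_pow_scale)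
qed

lemma eigenvector_in_gen_eig: "f x = l \<odot> x \<Longrightarrow> x \<in> gen_eig l"
  unfolding gen_eig_def by (auto simp: shift_def intro!: exI[of _ 1])

lemma shift_gen_eig:
  assumes "x \<in> gen_eig l"
  shows "shift m x \<in> gen_eig l"
proof -
  obtain n where "(shift l ^^ n) x = 0"
    using assms by (auto simp: gen_eig_def)
  then have "(shift l ^^ n) (shift m x) = 0"
    unfolding shift_shift_pow[symmetric] by (simp add: shift_def f.zero)
  then show ?thesis
    by (auto simp: gen_eig_def)
qed

text \<open>On an eigenvector for \<open>m\<close>, the operator \<open>f - l\<close> is multiplication by the nonzero scalar
  \<open>m - l\<close>, hence not nilpotent.\<close>

lemma shift_kernel_gen_eig:
  assumes "x \<in> gen_eig l" "shift m x = 0" "l \<noteq> m"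
  shows "x = 0"
proof -
  from assms(1) obtain n where n: "(shift l ^^ n) x = 0"
    by (auto simp: gen_eig_def)
  have "shift l x = (m - l) \<odot> x"
    using assms(2) by (simp add: shift_def algebra_simps)
  then have "(shift l ^^ n) x = (m - l) ^ n \<odot> x" for n
  proof (induction n)
    case (Suc n)
    then show ?case
      using module_hom.scale[OF linear_shift[unfolded linear_iff_module_hom]]
      by (simp add: mult.commute)
  qed simp
  with n assms(3) show ?thesis
    by simp
qed

text \<open>The map \<open>f - m\<close> preserves the generalized eigenspace of \<open>l\<close> and is injective on it, so
  none of its powers kills a nonzero vector there.\<close>

lemma gen_eig_disjoint:
  assumes "x \<in> gen_eig l" "x \<in> gen_eig m" "l \<noteq> m"
  shows "x = 0"
proof -
  have "x = 0" if "(shift m ^^ n) x = 0" "x \<in> gen_eig l" for n x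
    using that
  proof (induction n arbitrary: x)
    case (Suc n)
    have "shift m x = 0"
    proof (rule Suc.IH)
      show "(shift m ^^ n) (shift m x) = 0"
        using Suc.prems(1) unfolding funpow_Suc_right by simp
      show "shift m x \<in> gen_eig l"
        using Suc.prems(2) by (rule shift_gen_eig)
    qed
    then show ?case
      using shift_kernel_gen_eig Suc.prems(2) assms(3) by blast
  qed simp
  then show ?thesis
    using assms(1,2) by (auto simp: gen_eig_def)
qed

lemma poly_act_bound:
  assumes "degree p \<le> n"
  shows "poly_act p v = (\<Sum>i\<le>n. coeff p i \<odot> (f ^^ i) v)"
  unfolding poly_act_def using assms
  by (intro sum.mono_neutral_left) (auto simp: coeff_eq_0)

text \<open>The one instance of multiplicativity of \<open>p \<mapsto> p(f)\<close> that is needed to peel off the roots of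
  a polynomial.\<close>

lemma poly_act_linear_factor: "poly_act ([:-a, 1:] * q) v = shift a (poly_act q v)"
proof -
  have deg: "degree ([:-a, 1:] * q) \<le> Suc (degree q)"
    using degree_mult_le[of "[:-a, 1:]" q] by simp
  have q: "poly_act q v = (\<Sum>i\<le>Suc (degree q). coeff q i \<odot> (f ^^ i) v)"
    by (rule poly_act_bound) simp
  have c: "[:-a, 1:] * q = pCons 0 q - smult a q"
    by simp
  have "poly_act ([:-a, 1:] * q) v =
      (\<Sum>i\<le>Suc (degree q). coeff (pCons 0 q) i \<odot> (f ^^ i) v) - a \<odot> poly_act q v"
    unfolding poly_act_bound[OF deg] q
    unfolding c
    by (simp only: coeff_diff coeff_smult scale_left_diff_distrib sum_subtractf
        scale_sum_right scale_scale)
  also have "(\<Sum>i\<le>Suc (degree q). coeff (pCons 0 q) i \<odot> (f ^^ i) v) = f (poly_act q v)"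
    by (simp add: sum.atMost_Suc_shift poly_act_def f.sum f.scale del: sum.atMost_Suc)
  finally show ?thesis
    by (simp add: shift_def)
qed

text \<open>Otherwise the powers of \<open>f\<close> applied to \<open>v\<close> would form an infinite independent set.\<close>

lemma annihilating_poly_exists: "\<exists>p. p \<noteq> 0 \<and> poly_act p v = 0"
proof (rule ccontr)
  assume "\<not> ?thesis"
  then have none: "p = 0" if "poly_act p v = 0" for p
    using that by blast
  let ?g = "\<lambda>i. (f ^^ i) v"
  have indep: "\<forall>i\<in>I. c i = 0" if I: "finite I" and s: "(\<Sum>i\<in>I. c i \<odot> ?g i) = 0" for I c
  proof -
    define p where "p = (\<Sum>i\<in>I. monom (c i) i)"
    have cp: "coeff p i = (if i \<in> I then c i else 0)" for i
      using I by (simp add: p_def coeff_sum)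
    obtain n where n: "degree p \<le> n" "I \<subseteq> {..n}"
      using I by (metis finite_nat_iff_bounded_le finite_insert insert_subset atMost_iff)
    have "poly_act p v = (\<Sum>i\<le>n. coeff p i \<odot> ?g i)"
      using n(1) by (rule poly_act_bound)
    also have "\<dots> = (\<Sum>i\<in>I. c i \<odot> ?g i)"
      using n(2) by (intro sum.mono_neutral_cong_right) (auto simp: cp)
    finally have "p = 0"
      using s none by simp
    then show ?thesis
      using cp by (metis coeff_0)
  qed
  have inj: "inj ?g"
  proof (rule injI, rule ccontr)
    fix i j
    assume eq: "?g i = ?g j" and "i \<noteq> j"
    then show False
      using indep[of "{i, j}" "\<lambda>k. if k = i then 1 else - 1"] by simp
  qed
  have "independent (range ?g)"
    unfolding independent_explicit_module
  proof (intro allI impI)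
    fix t u w
    assume t: "finite t" "t \<subseteq> range ?g" and s: "(\<Sum>w\<in>t. u w \<odot> w) = 0" and w: "w \<in> t"
    obtain I where I: "t = ?g ` I"
      using t(2) by (meson subset_imageE)
    have injI: "inj_on ?g I"
      using inj by (rule inj_on_subset) simp
    have "finite I"
      using t(1) injI unfolding I by (rule finite_imageD)
    moreover have "(\<Sum>i\<in>I. u (?g i) \<odot> ?g i) = 0"
      using s unfolding I by (simp add: sum.reindex[OF injI])
    ultimately have "\<forall>i\<in>I. u (?g i) = 0"
      by (rule indep)
    then show "u w = 0"
      using w I by auto
  qed
  then show False
    using finiteI_independent finite_imageD[OF _ inj] infinite_UNIV_nat by blast
qed

text \<open>Split linear factors \<open>X - a\<close> off a polynomial that annihilates \<open>v\<close>. The first factor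
  whose removal leaves a polynomial \<open>q\<close> with \<open>q(f) v \<noteq> 0\<close> exhibits \<open>q(f) v\<close> as
  an eigenvector for \<open>a\<close>; it lies in \<open>W\<close> because \<open>W\<close> is invariant. Such a factor
  exists since nonzero constants do not annihilate \<open>v\<close>.\<close>

lemma eigenvalue_exists:
  assumes W: "subspace W" "f ` W \<subseteq> W" and "v \<in> W" "v \<noteq> 0"
  shows "eigenvalues_on W \<noteq> {}"
proof -
  have pow: "(f ^^ i) v \<in> W" for i
    using assms by (induction i) auto
  then have act: "poly_act p v \<in> W" for p
    unfolding poly_act_def using W(1) by (intro subspace_sum subspace_scale)
  have "eigenvalues_on W \<noteq> {}" if "p \<noteq> 0" "poly_act p v = 0" for p
    using that
  proof (induction "degree p" arbitrary: p)
    case 0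
    then have "coeff p 0 \<odot> v = 0"
      by (simp add: poly_act_def)
    moreover have "coeff p 0 \<noteq> 0"
      using 0 by (metis leading_coeff_0_iff)
    ultimately show ?case
      using assms(4) by simp
  next
    case (Suc d)
    then obtain a where "poly p a = 0"
      using alg_closed_imp_poly_has_root[of p] by auto
    then obtain q where q: "p = [:-a, 1:] * q"
      by (auto simp: poly_eq_0_iff_dvd)
    with Suc.prems have "q \<noteq> 0"
      by auto
    have "degree q = d"
      using Suc.hyps(2) \<open>q \<noteq> 0\<close> unfolding q by (subst (asm) degree_mult_eq) auto
    show ?case
    proof (cases "poly_act q v = 0")
      case True
      then show ?thesis
        using Suc.hyps(1) \<open>degree q = d\<close> \<open>q \<noteq> 0\<close> by blast
    next
      case False
      have "f (poly_act q v) = a \<odot> poly_act q v"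
        using Suc.prems(2) unfolding q poly_act_linear_factor by (simp add: shift_def)
      then show ?thesis
        using act False unfolding eigenvalues_on_def by blast
    qed
  qed
  then show ?thesis
    using annihilating_poly_exists by blast
qed

text \<open>A right inverse \<open>h\<close> of \<open>g\<close> on \<open>U\<close> is injective, hence maps \<open>U\<close> onto
  \<open>U\<close> by finite dimension; every element of \<open>U\<close> is then some \<open>h y\<close>, and
  \<open>g (h y) = y\<close>.\<close>

lemma surj_on_subspace_imp_kernel_trivial:
  assumes g: "Vector_Spaces.linear scale scale g" and U: "subspace U" and gU: "g ` U = U"
    and x: "x \<in> U" "g x = 0"
  shows "x = 0"
proof -
  interpret finite_dimensional_vector_space_pair_1 scale Basis scale
    by unfold_locales
  obtain h where h: "range h \<subseteq> U" "Vector_Spaces.linear scale scale h" "\<forall>v\<in>U. g (h v) = v"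
    using linear_exists_right_inverse_on[OF g U] gU by auto
  have "inj_on h (span U)"
    using h(3) unfolding iffD2[OF span_eq_iff U] by (intro inj_on_inverseI[of _ g]) blast
  then have "dim (h ` U) = dim U"
    using dim_image_eq[OF h(2)] by blast
  moreover have "subspace (h ` U)"
    using h(2) U by (simp add: linear_iff_module_hom module_hom.subspace_image)
  ultimately have "h ` U = U"
    using h(1) U by (intro subspace_dim_equal) auto
  then obtain y where "y \<in> U" "x = h y"
    using x(1) by blast
  then have "y = 0"
    using h(3) x(2) by auto
  then show ?thesis
    using \<open>x = h y\<close> h(2) by (simp add: linear_iff_module_hom module_hom.zero)
qed

text \<open>The images of \<open>W\<close> under the powers of \<open>f - l\<close> decrease and hence become stationary.
  On the stable image \<open>U\<close> the map \<open>f - l\<close> is surjective, thus injective, so \<open>U\<close>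
  contains no nonzero generalized eigenvector for \<open>l\<close>. With \<open>n\<close> the exponent at which the
  images stabilize, each \<open>w\<close> in \<open>W\<close> has the same image under \<open>(f - l)\<^sup>n\<close> as some
  \<open>u\<close> in \<open>U\<close>, and \<open>w - u\<close> is the component in the generalized eigenspace.\<close>

lemma fitting_decomposition:
  assumes W: "subspace W" "f ` W \<subseteq> W"
  obtains U where "subspace U" "f ` U \<subseteq> U" "U \<subseteq> W" "U \<inter> gen_eig l = {0}"
    "W = {x + y |x y. x \<in> U \<and> y \<in> W \<inter> gen_eig l}"
proof -
  let ?R = "\<lambda>n. (shift l ^^ n) ` W"
  have shiftW: "shift l x \<in> W" if "x \<in> W" for x
    using that W by (auto simp: shift_def intro!: subspace_diff subspace_scale)
  have powW: "(shift l ^^ n) x \<in> W" if "x \<in> W" for n x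
    using that by (induction n) (auto intro: shiftW)
  have sub: "subspace (?R n)" for n
    using module_hom_shift_pow W(1) by (rule module_hom.subspace_image)
  \<comment> \<open>an image of least dimension is stable\<close>
  obtain n where n: "dim (?R n) \<le> dim (?R m)" for m
    using ex_has_least_nat[of "\<lambda>_. True" _ "\<lambda>n. dim (?R n)"] by blast
  define U where "U = ?R n"
  have U: "subspace U"
    unfolding U_def by (rule sub)
  have step: "?R (Suc n) = shift l ` U"
    by (auto simp: U_def image_image)
  have "?R (Suc n) \<subseteq> ?R n"
    using shiftW by (auto simp: funpow_swap1)
  then have "?R (Suc n) = ?R n"
    by (rule subspace_dim_equal[OF sub sub _ n])
  then have shiftU: "shift l ` U = U"
    unfolding step U_def[symmetric] .
  have powU: "(shift l ^^ m) ` U = U" for m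
    by (induction m) (simp_all only: funpow.simps image_comp[symmetric] shiftU image_ident id_def)
  have ker: "x = 0" if "x \<in> U" "x \<in> gen_eig l" for x
    using that surj_on_subspace_imp_kernel_trivial[OF linear_shift_pow U powU]
    by (auto simp: gen_eig_def)
  have UW: "U \<subseteq> W"
    using powW by (auto simp: U_def)
  have "f ` U \<subseteq> U"
    using W(2) by (auto simp: U_def f_shift_pow)
  moreover have "U \<inter> gen_eig l = {0}"
    using ker subspace_0[OF U] subspace_0[OF subspace_gen_eig] by auto
  moreover have "W = {x + y |x y. x \<in> U \<and> y \<in> W \<inter> gen_eig l}" (is "W = ?S")
  proof
    show "?S \<subseteq> W"
      using UW W(1) by (auto intro: subspace_add)
    show "W \<subseteq> ?S"
    proof
      fix w
      assume w: "w \<in> W"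
      then have "(shift l ^^ n) w \<in> (shift l ^^ n) ` U"
        unfolding powU by (simp add: U_def)
      then obtain u where u: "u \<in> U" "(shift l ^^ n) w = (shift l ^^ n) u"
        by blast
      then have "w - u \<in> W \<inter> gen_eig l"
        using w UW W(1) by (auto simp: gen_eig_def shift_pow_diff intro!: subspace_diff exI[of _ n])
      moreover have "w = u + (w - u)"
        by simp
      ultimately show "w \<in> ?S"
        using u(1) by blast
    qed
  qed
  ultimately show ?thesis
    using that U UW by blast
qed

text \<open>For \<open>W\<close> the whole space: the algebraic multiplicities add up to the dimension. Invariant
  subspaces are what makes the induction on the dimension possible.\<close>

theorem sum_dim_gen_eig_on:
  assumes "subspace W" "f ` W \<subseteq> W"
  shows "finite (eigenvalues_on W) \<and> (\<Sum>l\<in>eigenvalues_on W. dim (W \<inter> gen_eig l)) = dim W"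
  using assms
proof (induction "dim W" arbitrary: W rule: less_induct)
  case less
  show ?case
  proof (cases "eigenvalues_on W = {}")
    case True
    then have "W \<subseteq> {0}"
      using eigenvalue_exists less.prems by blast
    then have "dim W = 0"
      by simp
    then show ?thesis
      using True by simp
  next
    case False
    then obtain l where l: "l \<in> eigenvalues_on W"
      by blast
    obtain U where U: "subspace U" "f ` U \<subseteq> U" "U \<subseteq> W" "U \<inter> gen_eig l = {0}"
      "W = {x + y |x y. x \<in> U \<and> y \<in> W \<inter> gen_eig l}"
      using less.prems by (rule fitting_decomposition)
    let ?K = "W \<inter> gen_eig l"
    have K: "subspace ?K"
      using less.prems(1) subspace_gen_eig by (rule subspace_inter)
    have "U \<inter> ?K = {0}"
      using U(3,4) by blast
    then have dimW: "dim W = dim U + dim ?K"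
      using dim_sums_Int[OF U(1) K] unfolding U(5)[symmetric] by simp
    obtain x where "x \<in> W" "x \<noteq> 0" "f x = l \<odot> x"
      using l by (auto simp: eigenvalues_on_def)
    then have "\<not> ?K \<subseteq> {0}"
      using eigenvector_in_gen_eig by blast
    then have "dim ?K \<noteq> 0"
      unfolding dim_eq_0 .
    with dimW have "dim U < dim W"
      by linarith
    then have IH: "finite (eigenvalues_on U)"
      "(\<Sum>m\<in>eigenvalues_on U. dim (U \<inter> gen_eig m)) = dim U"
      using less.hyps U(1,2) by blast+
    have other: "W \<inter> gen_eig m = U \<inter> gen_eig m" if m: "m \<noteq> l" for m
    proof (intro equalityI subsetI)
      fix x
      assume x: "x \<in> W \<inter> gen_eig m"
      then obtain u k where uk: "x = u + k" "u \<in> U" "k \<in> ?K"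
        using U(5) by blast
      \<comment> \<open>apply \<open>(f - m)\<^sup>n\<close> to \<open>x = u + k\<close>: both summands stay in their subspaces, so each is killed\<close>
      obtain n where n: "(shift m ^^ n) x = 0"
        using x by (auto simp: gen_eig_def)
      have powU: "(shift m ^^ i) u \<in> U" for i
        using uk(2) U(1,2)
        by (induction i) (auto simp: shift_def intro!: subspace_diff subspace_scale)
      have "(shift m ^^ i) k \<in> gen_eig l" for i
        using uk(3) by (induction i) (auto intro: shift_gen_eig)
      moreover have "(shift m ^^ n) k = - (shift m ^^ n) u"
        using n uk(1) by (simp add: shift_pow_add eq_neg_iff_add_eq_0 add.commute)
      ultimately have "(shift m ^^ n) k \<in> U \<inter> gen_eig l"
        using powU U(1) by (metis IntI subspace_neg)
      then have "k \<in> gen_eig m"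
        using U(4) by (auto simp: gen_eig_def)
      then have "k = 0"
        using gen_eig_disjoint uk(3) m by blast
      then show "x \<in> U \<inter> gen_eig m"
        using uk x by simp
    qed (use U(3) in auto)
    have notin: "l \<notin> eigenvalues_on U"
      using U(4) eigenvector_in_gen_eig by (auto simp: eigenvalues_on_def)
    have spec: "eigenvalues_on W = insert l (eigenvalues_on U)"
    proof (intro equalityI subsetI)
      fix m
      assume "m \<in> eigenvalues_on W"
      then obtain x where x: "x \<in> W" "x \<noteq> 0" "f x = m \<odot> x"
        by (auto simp: eigenvalues_on_def)
      then have "x \<in> U" if "m \<noteq> l"
        using other[OF that] eigenvector_in_gen_eig by blast
      then show "m \<in> insert l (eigenvalues_on U)"
        using x by (auto simp: eigenvalues_on_def)
    qed (use l U(3) in \<open>auto simp: eigenvalues_on_def\<close>)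
    have "(\<Sum>m\<in>eigenvalues_on U. dim (W \<inter> gen_eig m)) = dim U"
      unfolding IH(2)[symmetric]
    proof (rule sum.cong)
      show "dim (W \<inter> gen_eig m) = dim (U \<inter> gen_eig m)" if "m \<in> eigenvalues_on U" for m
        using other[of m] that notin by metis
    qed simp
    then have "(\<Sum>m\<in>eigenvalues_on W. dim (W \<inter> gen_eig m)) = dim W"
      unfolding spec sum.insert[OF IH(1) notin] dimW by linarith
    with IH(1) show ?thesis
      unfolding spec by blast
  qed
qed

end

section \<open>Commutative quaternion vectors as a complex vector space\<close>

text \<open>The pairing of \<open>1\<close> with \<open>j\<close> makes the complex coordinates of a quaternion its
  components \<open>t + i x\<close> and \<open>y + i z\<close>.\<close>

definition cq_basis :: "(cquat ^ 'n) set" where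
  "cq_basis = (\<lambda>(i, e). axis i e) ` (UNIV \<times> {1, cq_j})"

lemma cquat_one_neq_j: "1 \<noteq> cq_j"
  by (simp add: cquat_defs cq_j_def)

lemma inj_on_axis: "inj_on (\<lambda>(i, e). axis i e :: cquat ^ 'n) (UNIV \<times> {1, cq_j})"
  by (auto simp: inj_on_def axis_eq_axis cquat_defs cq_j_def)

lemma card_cq_basis: "card (cq_basis :: (cquat ^ 'n) set) = 2 * CARD('n)"
  unfolding cq_basis_def
  by (simp add: card_image[OF inj_on_axis] card_cartesian_product cquat_one_neq_j)

lemma sum_cq_scale_axis:
  "(\<Sum>i\<in>UNIV. cq_scale (c i) (axis i 1) + cq_scale (d i) (axis i cq_j)) =
    (\<chi> i. cq_of_complex (c i) + cq_of_complex (d i) * cq_j)"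
  by (simp add: vec_eq_iff cq_scale_def axis_def if_distrib[of "\<lambda>x. _ * x"] sum.distrib
      cong: if_cong)

lemma sum_cq_basis:
  "(\<Sum>b\<in>cq_basis. g b) = (\<Sum>i\<in>UNIV. g (axis i 1) + g (axis i cq_j))"
proof -
  have "(\<Sum>b\<in>cq_basis. g b) = (\<Sum>(i, e)\<in>UNIV \<times> {1, cq_j}. g (axis i e))"
    unfolding cq_basis_def by (subst sum.reindex[OF inj_on_axis]) (simp add: case_prod_beta)
  also have "\<dots> = (\<Sum>i\<in>UNIV. \<Sum>e\<in>{1, cq_j}. g (axis i e))"
    by (rule sum.cartesian_product[symmetric])
  finally show ?thesis
    by (simp add: cquat_one_neq_j)
qed

lemma cquat_cartesian: "cq_of_complex a + cq_of_complex b * cq_j = CQuat (Re a) (Im a) (Re b) (Im b)"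
  by (simp add: cq_of_complex_eq cq_j_def cquat_defs)

interpretation cq_fin: finite_dimensional_vector_space cq_scale "cq_basis :: (cquat ^ 'n) set"
proof
  show fin: "finite (cq_basis :: (cquat ^ 'n) set)"
    by (simp add: cq_basis_def)
  show "\<not> cq.dependent (cq_basis :: (cquat ^ 'n) set)"
    unfolding cq.dependent_finite[OF fin]
  proof clarify
    fix u and b :: "cquat ^ 'n"
    assume "(\<Sum>b\<in>cq_basis. cq_scale (u b) b) = (0 :: cquat ^ 'n)"
      and b: "b \<in> cq_basis" "u b \<noteq> 0"
    then have "u (axis i 1) = 0 \<and> u (axis i cq_j) = 0" for i
      unfolding sum_cq_basis sum_cq_scale_axis cquat_cartesian vec_eq_iff
      by (simp add: zero_cquat_def complex_eq_iff)
    with b show False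
      by (auto simp: cq_basis_def)
  qed
  have "x \<in> cq.span cq_basis" for x :: "cquat ^ 'n"
  proof -
    have "axis i 1 \<in> cq_basis" "axis i cq_j \<in> cq_basis" for i :: 'n
      by (auto simp: cq_basis_def)
    then have "(\<Sum>i\<in>UNIV. cq_scale (Complex (cq_t (x $ i)) (cq_x (x $ i))) (axis i 1) +
        cq_scale (Complex (cq_y (x $ i)) (cq_z (x $ i))) (axis i cq_j)) \<in> cq.span cq_basis"
      by (intro cq.span_sum cq.span_add cq.span_scale cq.span_base)
    also have "(\<Sum>i\<in>UNIV. cq_scale (Complex (cq_t (x $ i)) (cq_x (x $ i))) (axis i 1) +
        cq_scale (Complex (cq_y (x $ i)) (cq_z (x $ i))) (axis i cq_j)) = x"
      by (simp add: sum_cq_scale_axis cquat_cartesian vec_eq_iff)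
    finally show ?thesis .
  qed
  then show "cq.span (cq_basis :: (cquat ^ 'n) set) = UNIV"
    by auto
qed

theorem theorem4p4:
  fixes A :: "cquat ^ 'n ^ 'n"
  shows "finite {l. complex_eigenvalue A l} \<and>
    (\<Sum>l | complex_eigenvalue A l. alg_mult A l) = 2 * CARD('n)"
proof -
  interpret endomorphism cq_scale cq_basis "(*v) A"
  proof unfold_locales
    show "A *v (x + y) = A *v x + A *v y" for x y
      by (rule matrix_vector_right_distrib)
    show "A *v cq_scale c x = cq_scale c (A *v x)" for c x
      by (simp add: vec_eq_iff cq_scale_def matrix_vector_mult_def sum_distrib_left mult.left_commute)
  qed
  have "eigenvalues_on UNIV = {l. complex_eigenvalue A l}"
    unfolding eigenvalues_on_def complex_eigenvalue_def cq_scale_def by blast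
  moreover have "gen_eig l = gen_eigenspace A l" for l
    unfolding gen_eig_def gen_eigenspace_def shift_def[abs_def] cq_scale_def ..
  ultimately show ?thesis
    using sum_dim_gen_eig_on[OF cq.subspace_UNIV subset_UNIV]
    unfolding alg_mult_def Int_UNIV_left cq_fin.dim_UNIV card_cq_basis by (simp only:)
qed

end
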